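(* Let $D>0$ be real, $d\ge2$ an integer, and $$a_0:=2^{-1+2/d}\,d^{-1/(d-1)}\,D^{1/(d(d-1))}.$$ Then there is a unique $f\in K(d,D)$, namely $$f(x)=\frac{(x+a_0i)^d+(x-a_0i)^d}{2},$$ satisfying $$|f(a_0i)|=2\,d^{-d/(d-1)}\,D^{1/(d-1)}.$$
   Context: For a monic polynomial $f(x)=\prod_{k=1}^d(x-x_k)$ the discriminant is $\Delta_f=\prod_{1\le j<k\le d}(x_j-x_k)^2$. $K(d,D)$ denotes the set of monic polynomials of degree $d$ in $\mathbb{R}[x]$ all of whose $d$ roots (counted with multiplicity) are real and whose discriminant equals $D$. Here $i=\sqrt{-1}$. *)

theory Defs
  imports
    "HOL-Computational_Algebra.Fundamental_Theorem_Algebra"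
    "HOL-Combinatorics.Permutations"
    "HOL-Analysis.Analysis"
begin

(* The discriminant of a monic polynomial, read off from any listing x 1, ..., x d of its d complex
   roots with multiplicity. The value does not depend on the listing: see discriminant_eq. For
   polynomials that are not monic there is no such listing, and the value is unspecified. *)
definition discriminant :: "complex poly \<Rightarrow> complex" where
  "discriminant f =
     (THE \<Delta>. \<exists>x :: nat \<Rightarrow> complex.
        f = (\<Prod>k\<in>{1..degree f}. [:- x k, 1:]) \<and>
        \<Delta> = (\<Prod>(j, k)\<in>{(j, k). 1 \<le> j \<and> j < k \<and> k \<le> degree f}. (x j - x k)\<^sup>2))"

definition K :: "nat \<Rightarrow> real \<Rightarrow> real poly set" where
  "K d D =
     {f. lead_coeff f = 1 \<and> degree f = d \<and>
         (\<forall>z::complex. poly (map_poly complex_of_real f) z = 0 \<longrightarrow> z \<in> \<real>) \<and>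
         discriminant (map_poly complex_of_real f) = complex_of_real D}"

lemma prod_pairs_permutes:
  fixes h :: "nat \<Rightarrow> nat \<Rightarrow> 'a :: comm_monoid_mult"
  assumes p: "p permutes {1..d}" and sym: "\<And>j k. h j k = h k j"
  defines "S \<equiv> {(j, k). 1 \<le> j \<and> j < k \<and> k \<le> d}"
  shows "(\<Prod>(j, k)\<in>S. h (p j) (p k)) = (\<Prod>(j, k)\<in>S. h j k)"
proof -
  define g where "g q = (\<lambda>(j, k). (min (q j) (q k), max (q j) (q k)))" for q :: "nat \<Rightarrow> nat"
  have g_in: "g q s \<in> S" if q: "q permutes {1..d}" and s: "s \<in> S" for q s
  proof -
    obtain j k where jk: "s = (j, k)" "1 \<le> j" "j < k" "k \<le> d"
      using s by (auto simp: S_def)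
    have "q j \<in> {1..d}" "q k \<in> {1..d}"
      using jk permutes_in_image[OF q] by auto
    moreover have "q j \<noteq> q k"
      using jk(3) permutes_inj[OF q] by (auto dest: injD)
    ultimately show ?thesis
      unfolding g_def jk(1) S_def by (auto simp: min_def max_def)
  qed
  have g_inv: "g q (g q' s) = s" if "q \<circ> q' = id" "s \<in> S" for q q' s
  proof -
    have qq: "q (q' i) = i" for i
      using that(1) by (metis comp_apply id_apply)
    show ?thesis
      using that(2) by (auto simp: g_def S_def min_def max_def qq)
  qed
  have p': "inv p permutes {1..d}"
    using p by (rule permutes_inv)
  show ?thesis
  proof (rule prod.reindex_bij_witness[of S "g (inv p)" "g p"])
    fix s assume s: "s \<in> S"
    show "g (inv p) (g p s) = s"
      using s permutes_inv_o(2)[OF p] by (rule g_inv[rotated])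
    show "g p (g (inv p) s) = s"
      using s permutes_inv_o(1)[OF p] by (rule g_inv[rotated])
    show "g p s \<in> S" "g (inv p) s \<in> S"
      using g_in p p' s by auto
    show "(case g p s of (j, k) \<Rightarrow> h j k) = (case s of (j, k) \<Rightarrow> h (p j) (p k))"
      using sym by (auto simp: g_def min_def max_def split: prod.splits)
  qed
qed

lemma discriminant_eq:
  fixes x :: "nat \<Rightarrow> complex"
  shows "discriminant (\<Prod>k\<in>{1..d}. [:- x k, 1:]) =
           (\<Prod>(j, k)\<in>{(j, k). 1 \<le> j \<and> j < k \<and> k \<le> d}. (x j - x k)\<^sup>2)"
proof -
  have deg: "degree (\<Prod>k\<in>{1..d}. [:- x k, 1:]) = d"
    by (subst degree_prod_sum_eq) auto
  have roots: "proots (\<Prod>k\<in>{1..d}. [:- y k, 1:]) = image_mset y (mset_set {1..d})"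
    for y :: "nat \<Rightarrow> complex"
  proof -
    have "(\<Sum>k\<in>A. {#y k#}) = image_mset y (mset_set A)" if "finite A" for A
      using that by induction auto
    then show ?thesis
      by (subst proots_prod) auto
  qed
  have uniq: "(\<Prod>(j, k)\<in>{(j, k). 1 \<le> j \<and> j < k \<and> k \<le> d}. (y j - y k)\<^sup>2) =
              (\<Prod>(j, k)\<in>{(j, k). 1 \<le> j \<and> j < k \<and> k \<le> d}. (x j - x k)\<^sup>2)"
    (is "?P y = ?P x")
    if eq: "(\<Prod>k\<in>{1..d}. [:- x k, 1:]) = (\<Prod>k\<in>{1..d}. [:- y k, 1:])" for y
  proof -
    have "image_mset y (mset_set {1..d}) = image_mset x (mset_set {1..d})"
      using roots[of x] roots[of y] eq by simp
    then obtain p where p: "p permutes {1..d}" "\<forall>i\<in>{1..d}. y i = x (p i)"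
      using image_mset_eq_implies_permutes[of "{1..d}" y x] by auto
    have "?P y = (\<Prod>(j, k)\<in>{(j, k). 1 \<le> j \<and> j < k \<and> k \<le> d}. (x (p j) - x (p k))\<^sup>2)"
      using p(2) by (intro prod.cong) auto
    also have "\<dots> = ?P x"
      by (rule prod_pairs_permutes[OF p(1), of "\<lambda>j k. (x j - x k)\<^sup>2"])
         (rule power2_commute)
    finally show ?thesis .
  qed
  show ?thesis
    unfolding discriminant_def deg by (rule the_equality) (use uniq in blast)+
qed

end

theory Submission
  imports Defs "Jordan_Normal_Form.Schur_Decomposition"
begin

text \<open>
  The Cayley transform \<open>u = (x - a i) / (x + a i)\<close> maps the roots of a real-rooted polynomial
  \<open>g\<close> to the unit circle and turns the product of the squared distances of the \<open>u\<close>'s into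
  \<open>(2a)^(d(d-1)) D / |g(a i)|^(2(d-1))\<close>. By Hadamard's inequality for the Vandermonde matrix \<open>V\<close>,
  this product is at most \<open>d^d\<close>; the prescribed value of \<open>|g(a i)|\<close> is exactly the case of equality.
  Equality forces the Gram matrix \<open>V V*\<close>, of trace \<open>d^2\<close> and determinant \<open>d^d\<close>, to
  have all eigenvalues equal to \<open>d\<close> (AM-GM), hence to be diagonal; so all the powers \<open>u^d\<close> agree
  with one constant \<open>c\<close> on the unit circle, and \<open>(1 - c) g = (x - a i)^d - c (x + a i)^d\<close>.
  Evaluating at \<open>a i\<close> gives \<open>|1 - c| = 2\<close>, that is, \<open>c = -1\<close>.
\<close>

section \<open>Traces of similar matrices\<close>

lemma trace_mult_commute:
  fixes X Y :: "'a :: comm_semiring_0 Matrix.mat"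
  assumes "X \<in> carrier_mat n n" "Y \<in> carrier_mat n n"
  shows "(\<Sum>i<n. (X * Y) $$ (i, i)) = (\<Sum>i<n. (Y * X) $$ (i, i))"
proof -
  have "(\<Sum>i<n. (X * Y) $$ (i, i)) = (\<Sum>i<n. \<Sum>k<n. X $$ (i, k) * Y $$ (k, i))"
    using assms by (auto simp: scalar_prod_def atLeast0LessThan)
  also have "\<dots> = (\<Sum>k<n. \<Sum>i<n. Y $$ (k, i) * X $$ (i, k))"
    by (subst sum.swap) (simp add: mult.commute)
  also have "\<dots> = (\<Sum>k<n. (Y * X) $$ (k, k))"
    using assms by (auto simp: scalar_prod_def atLeast0LessThan)
  finally show ?thesis .
qed

lemma trace_similar:
  fixes X Y :: "'a :: comm_ring_1 Matrix.mat"
  assumes "X \<in> carrier_mat n n" "similar_mat X Y"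
  shows "(\<Sum>i<n. X $$ (i, i)) = (\<Sum>i<n. Y $$ (i, i))"
proof -
  obtain P Q where PQ: "P \<in> carrier_mat n n" "Q \<in> carrier_mat n n" "Y \<in> carrier_mat n n"
      "Q * P = 1\<^sub>m n" "X = P * Y * Q"
    using assms unfolding similar_mat_def similar_mat_wit_def by (auto simp: Let_def)
  have "(\<Sum>i<n. X $$ (i, i)) = (\<Sum>i<n. (Q * (P * Y)) $$ (i, i))"
    unfolding PQ(5) by (rule trace_mult_commute) (use PQ(1-3) in auto)
  also have "Q * (P * Y) = Q * P * Y"
    using PQ(1-3) by (intro assoc_mult_mat[symmetric]) auto
  also have "\<dots> = Y"
    using PQ(3,4) by simp
  finally show ?thesis .
qed

text \<open>Lets the trace of the square of a matrix be computed from its triangular form.\<close>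

lemma similar_mat_square:
  fixes X Y :: "'a :: semiring_1 Matrix.mat"
  assumes "similar_mat X Y"
  shows "similar_mat (X * X) (Y * Y)"
proof -
  obtain n where "{X, Y} \<subseteq> carrier_mat n n"
    using similar_matD[OF assms] by blast
  moreover obtain P Q where "similar_mat_wit X Y P Q"
    using assms by (auto simp: similar_mat_def)
  ultimately show ?thesis
    using similar_mat_wit_pow[of X Y P Q 2] by (auto simp: similar_mat_def numeral_2_eq_2)
qed

section \<open>Gram matrices and the equality case of Hadamard's inequality\<close>

text \<open>Pairing the eigenvalue equation with the eigenvector \<open>w\<close> gives
  \<open>e * N = M\<close>, where \<open>N\<close> is the squared norm of \<open>w\<close> and
  \<open>M\<close> that of its image under the adjoint of \<open>V\<close>.\<close>

lemma gram_eigenvalue_nonneg: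
  fixes V :: "complex Matrix.mat"
  assumes V: "V \<in> carrier_mat n n"
    and e: "eigenvalue (V * Matrix.mat n n (\<lambda>(i, j). cnj (V $$ (j, i)))) e"
  shows "\<exists>r\<ge>0. e = complex_of_real r"
proof -
  define A where "A = V * Matrix.mat n n (\<lambda>(i, j). cnj (V $$ (j, i)))"
  obtain v where v: "v \<in> carrier_vec n" "v \<noteq> 0\<^sub>v n" "A *\<^sub>v v = e \<cdot>\<^sub>v v"
    using e V unfolding A_def[symmetric] eigenvalue_def eigenvector_def by (auto simp: A_def)
  define w where "w k = vec_index v k" for k
  have A: "A $$ (i, k) = (\<Sum>m<n. V $$ (i, m) * cnj (V $$ (k, m)))" if "i < n" "k < n" for i k
    using that V by (auto simp: A_def scalar_prod_def atLeast0LessThan)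
  have Av: "(\<Sum>k<n. A $$ (i, k) * w k) = e * w i" if "i < n" for i
  proof -
    have "vec_index (A *\<^sub>v v) i = (\<Sum>k<n. A $$ (i, k) * w k)"
      using that V v(1) by (auto simp: A_def w_def scalar_prod_def atLeast0LessThan)
    then show ?thesis
      using that v by (simp add: w_def)
  qed
  define N where "N = (\<Sum>i<n. (cmod (w i))\<^sup>2)"
  define M where "M = (\<Sum>m<n. (cmod (\<Sum>k<n. cnj (V $$ (k, m)) * w k))\<^sup>2)"
  have "e * complex_of_real N = (\<Sum>i<n. cnj (w i) * (e * w i))"
    unfolding N_def of_real_sum sum_distrib_left
    by (intro sum.cong refl) (simp only: complex_norm_square, simp)
  also have "\<dots> = (\<Sum>i<n. cnj (w i) * (\<Sum>k<n. (\<Sum>m<n. V $$ (i, m) * cnj (V $$ (k, m))) * w k))"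
    by (intro sum.cong refl) (simp add: Av[symmetric] A)
  also have "\<dots> = (\<Sum>i<n. \<Sum>k<n. \<Sum>m<n. cnj (w i) * V $$ (i, m) * (cnj (V $$ (k, m)) * w k))"
    by (simp add: sum_distrib_left sum_distrib_right mult_ac)
  also have "\<dots> = (\<Sum>i<n. \<Sum>m<n. \<Sum>k<n. cnj (w i) * V $$ (i, m) * (cnj (V $$ (k, m)) * w k))"
    by (intro sum.cong refl sum.swap)
  also have "\<dots> = (\<Sum>m<n. \<Sum>i<n. \<Sum>k<n. cnj (w i) * V $$ (i, m) * (cnj (V $$ (k, m)) * w k))"
    by (rule sum.swap)
  also have "\<dots> = (\<Sum>m<n. (\<Sum>i<n. cnj (w i) * V $$ (i, m)) * (\<Sum>k<n. cnj (V $$ (k, m)) * w k))"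
    by (simp only: sum_product)
  also have "\<dots> = (\<Sum>m<n. (\<Sum>k<n. cnj (V $$ (k, m)) * w k) * cnj (\<Sum>k<n. cnj (V $$ (k, m)) * w k))"
    by (simp add: mult.commute)
  also have "\<dots> = complex_of_real M"
    unfolding M_def of_real_sum by (simp only: complex_norm_square)
  finally have eN: "e * complex_of_real N = complex_of_real M" .
  have "\<exists>i<n. w i \<noteq> 0"
    using v(1,2) unfolding w_def by (metis carrier_vecD eq_vecI index_zero_vec(1) index_zero_vec(2))
  then have "N > 0"
    unfolding N_def by (auto intro!: sum_pos2)
  moreover have "M \<ge> 0"
    unfolding M_def by (intro sum_nonneg) auto
  ultimately show ?thesis
    using eN by (intro exI[of _ "M / N"]) (auto simp: field_simps)
qed

text \<open>The function \<open>t - 1 - ln t\<close> is nonnegative and vanishes only at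
  \<open>t = 1\<close>. By the two hypotheses its values at \<open>t = r i / c\<close> sum to 0, so
  each of them is 0.\<close>

lemma arith_geometric_mean_equality:
  fixes r :: "nat \<Rightarrow> real"
  assumes r: "\<And>i. i < n \<Longrightarrow> r i \<ge> 0" and c: "c > 0"
    and s: "(\<Sum>i<n. r i) = real n * c" and p: "(\<Prod>i<n. r i) = c ^ n"
    and i: "i < n"
  shows "r i = c"
proof -
  \<comment> \<open>The product \<open>c ^ n\<close> is nonzero, which excludes zero factors and
    makes the logarithms below meaningful.\<close>
  have pos: "r i > 0" if "i < n" for i
  proof -
    have "(\<Prod>i<n. r i) \<noteq> 0"
      using p c by simp
    then have "r i \<noteq> 0"
      using that by (meson finite_lessThan lessThan_iff prod_zero)
    then show ?thesis
      using r[OF that] by simp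
  qed
  define h where "h i = r i / c - 1 - ln (r i / c)" for i
  have "(\<Sum>i<n. ln (r i / c)) = ln (\<Prod>i<n. r i / c)"
    by (intro ln_prod[symmetric]) (use pos c in force)+
  also have "\<dots> = 0"
    using p c by (simp add: prod_dividef)
  finally have "(\<Sum>i<n. h i) = 0"
    using s c by (simp add: h_def sum_subtractf sum_divide_distrib[symmetric])
  moreover have "h i \<ge> 0" if "i < n" for i
    using pos[OF that] c ln_le_minus_one[of "r i / c"] by (auto simp: h_def)
  ultimately have "h i = 0"
    using i by (subst (asm) sum_nonneg_eq_0_iff) auto
  then have "r i / c = 1"
    using pos[OF i] c by (intro ln_eq_minus_one) (auto simp: h_def)
  then show ?thesis
    using c by simp
qed

text \<open>The eigenvalues of \<open>A\<close> stand on the diagonal of a triangular matrix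
  \<open>B\<close> similar to \<open>A\<close>. Their sum \<open>n c\<close> and product
  \<open>c ^ n\<close> are those of equality in AM-GM, so all of them are \<open>c\<close>. The
  trace of the square of \<open>A\<close> then leaves no room for off-diagonal entries.\<close>

lemma gram_eq_diagonal:
  fixes V :: "complex Matrix.mat" and c :: real
  assumes V: "V \<in> carrier_mat n n"
  defines "A \<equiv> V * Matrix.mat n n (\<lambda>(i, j). cnj (V $$ (j, i)))"
  assumes c: "c > 0" and diag: "\<And>i. i < n \<Longrightarrow> A $$ (i, i) = complex_of_real c"
    and det: "Determinant.det A = complex_of_real (c ^ n)"
    and jk: "j < n" "k < n" "j \<noteq> k"
  shows "A $$ (j, k) = 0"
proof -
  have cA: "A \<in> carrier_mat n n"
    using V by (simp add: A_def)
  obtain es where "char_poly A = (\<Prod>a\<leftarrow>es. [:- a, 1:])"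
    using char_poly_factorized[OF cA] by blast
  then obtain B where B: "B \<in> carrier_mat n n" "upper_triangular B" "similar_mat A B"
    using schur_decomposition_exists[OF cA] by blast
  have "\<exists>t\<ge>0. B $$ (i, i) = complex_of_real t" if i: "i < n" for i
  proof -
    have "B $$ (i, i) \<in> set (diag_mat B)"
      using i B(1) by (auto simp: diag_mat_def)
    then have "poly (char_poly A) (B $$ (i, i)) = 0"
      by (auto simp: char_poly_similar[OF B(3)] char_poly_upper_triangular[OF B(1,2)]
            poly_prod_list prod_list_zero_iff)
    then have "eigenvalue A (B $$ (i, i))"
      by (simp add: eigenvalue_root_char_poly[OF cA])
    then show ?thesis
      unfolding A_def by (rule gram_eigenvalue_nonneg[OF V])
  qed
  then obtain r where r: "\<And>i. i < n \<Longrightarrow> r i \<ge> 0" "\<And>i. i < n \<Longrightarrow> B $$ (i, i) = complex_of_real (r i)"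
    by metis
  have "complex_of_real (\<Sum>i<n. r i) = (\<Sum>i<n. A $$ (i, i))"
    unfolding trace_similar[OF cA B(3)] using r by simp
  also have "\<dots> = complex_of_real (real n * c)"
    using diag by simp
  finally have s: "(\<Sum>i<n. r i) = real n * c"
    by (simp only: of_real_eq_iff)
  have "complex_of_real (\<Prod>i<n. r i) = Determinant.det B"
    using B(1) r(2) by (simp add: det_upper_triangular[OF B(2,1)] prod_list_diag_prod atLeast0LessThan)
  also have "\<dots> = complex_of_real (c ^ n)"
    using det det_similar[OF B(3)] by simp
  finally have p: "(\<Prod>i<n. r i) = c ^ n"
    by (simp only: of_real_eq_iff)
  have rc: "r i = c" if "i < n" for i
    using arith_geometric_mean_equality[OF r(1) c s p that] .
  have BB: "(B * B) $$ (i, i) = complex_of_real (c\<^sup>2)" if i: "i < n" for i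
  proof -
    have "(B * B) $$ (i, i) = (\<Sum>k<n. B $$ (i, k) * B $$ (k, i))"
      using i B(1) by (auto simp: scalar_prod_def atLeast0LessThan)
    \<comment> \<open>If \<open>k\<close> differs from \<open>i\<close>, one of the two factors lies
      below the diagonal of \<open>B\<close> and vanishes.\<close>
    also have "\<dots> = (\<Sum>k<n. if k = i then (complex_of_real c)\<^sup>2 else 0)"
    proof (intro sum.cong refl)
      fix k assume "k \<in> {..<n}"
      then show "B $$ (i, k) * B $$ (k, i) = (if k = i then (complex_of_real c)\<^sup>2 else 0)"
        using B(1,2) i r(2) rc unfolding upper_triangular_def
        by (cases k i rule: linorder_cases) (auto simp: power2_eq_square)
    qed
    also have "\<dots> = complex_of_real (c\<^sup>2)"
      using i by simp
    finally show ?thesis .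
  qed
  have herm: "A $$ (k, i) = cnj (A $$ (i, k))" if "i < n" "k < n" for i k
    using that V by (auto simp: A_def scalar_prod_def mult.commute)
  \<comment> \<open>The trace of \<open>A\<^sup>2\<close> is both the sum of all \<open>|A(i, k)|\<^sup>2\<close> and \<open>n c\<^sup>2\<close>, which
    the diagonal entries of \<open>A\<close> already use up.\<close>
  have "complex_of_real (\<Sum>i<n. \<Sum>k<n. (cmod (A $$ (i, k)))\<^sup>2) =
        (\<Sum>i<n. \<Sum>k<n. A $$ (i, k) * A $$ (k, i))"
    unfolding of_real_sum
    by (intro sum.cong refl, subst herm) (auto simp only: complex_norm_square lessThan_iff)
  also have "\<dots> = (\<Sum>i<n. (A * A) $$ (i, i))"
    using cA by (auto simp: scalar_prod_def atLeast0LessThan)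
  also have "\<dots> = (\<Sum>i<n. (B * B) $$ (i, i))"
    by (rule trace_similar[OF _ similar_mat_square[OF B(3)]]) (use cA in auto)
  also have "\<dots> = complex_of_real (\<Sum>i<n. c\<^sup>2)"
    using BB by simp
  finally have "(\<Sum>i<n. \<Sum>k<n. (cmod (A $$ (i, k)))\<^sup>2) = (\<Sum>i<n. c\<^sup>2)"
    by (simp only: of_real_eq_iff)
  then have sum0: "(\<Sum>i<n. (\<Sum>k<n. (cmod (A $$ (i, k)))\<^sup>2) - c\<^sup>2) = 0"
    by (simp add: sum_subtractf)
  have row: "(\<Sum>k<n. (cmod (A $$ (i, k)))\<^sup>2) - c\<^sup>2 = (\<Sum>k\<in>{..<n} - {i}. (cmod (A $$ (i, k)))\<^sup>2)"
    if "i < n" for i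
    using that diag by (subst sum.remove[of _ i]) auto
  have "(\<Sum>k\<in>{..<n} - {j}. (cmod (A $$ (j, k)))\<^sup>2) = 0"
    using sum0 row jk by (subst (asm) sum_nonneg_eq_0_iff) (auto simp: sum_nonneg)
  then show ?thesis
    using jk by (subst (asm) sum_nonneg_eq_0_iff) auto
qed

section \<open>Vandermonde matrices with nodes on the unit circle\<close>

lemma det_vandermonde:
  fixes u :: "nat \<Rightarrow> 'a :: idom"
  shows "Determinant.det (Matrix.mat n n (\<lambda>(j, m). u j ^ m)) = (\<Prod>k<n. \<Prod>j<k. u k - u j)"
proof -
  \<comment> \<open>The Newton basis turns the Vandermonde matrix into a lower triangular one.\<close>
  define N where "N m = (\<Prod>i<m. [:- u i, 1:])" for m
  have degN: "degree (N m) = m" for m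
    unfolding N_def by (subst degree_prod_sum_eq) auto
  have leadN: "coeff (N m) m = 1" for m
    using lead_coeff_prod[of "\<lambda>i. [:- u i, 1:]" "{..<m}"] degN[of m] by (simp add: N_def)
  have polyN: "poly (N m) x = (\<Prod>i<m. x - u i)" for m x
    by (simp add: N_def poly_prod)
  define V where "V = Matrix.mat n n (\<lambda>(j, m). u j ^ m)"
  define C where "C = Matrix.mat n n (\<lambda>(l, m). coeff (N m) l)"
  define L where "L = Matrix.mat n n (\<lambda>(j, m). poly (N m) (u j))"
  have carr: "V \<in> carrier_mat n n" "C \<in> carrier_mat n n" "L \<in> carrier_mat n n"
    by (auto simp: V_def C_def L_def)
  have "V * C = L"
  proof (rule eq_matI)
    fix j m assume "j < dim_row L" "m < dim_col L"
    then have jm: "j < n" "m < n"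
      by (auto simp: L_def)
    have "poly (N m) (u j) = (\<Sum>l\<le>m. coeff (N m) l * u j ^ l)"
      by (simp add: poly_altdef degN)
    also have "\<dots> = (\<Sum>l<n. coeff (N m) l * u j ^ l)"
      using jm by (intro sum.mono_neutral_left) (auto simp: coeff_eq_0 degN)
    finally show "(V * C) $$ (j, m) = L $$ (j, m)"
      using jm by (simp add: V_def C_def L_def scalar_prod_def atLeast0LessThan mult.commute)
  qed (auto simp: V_def C_def L_def)
  then have "Determinant.det V * Determinant.det C = Determinant.det L"
    using det_mult[OF carr(1,2)] by simp
  \<comment> \<open>\<open>C\<close> is upper triangular with unit diagonal because
    \<open>N m\<close> is monic of degree \<open>m\<close>; below, \<open>L\<close> is lower
    triangular because \<open>N m\<close> vanishes at \<open>u j\<close> for all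
    \<open>j < m\<close>.\<close>
  moreover have "Determinant.det C = 1"
    by (subst det_upper_triangular[OF _ carr(2)])
      (auto simp: C_def upper_triangular_def coeff_eq_0 degN leadN prod_list_diag_prod)
  moreover have "Determinant.det L = (\<Prod>k<n. \<Prod>j<k. u k - u j)"
    by (subst det_lower_triangular[OF _ carr(3)])
      (auto simp: L_def polyN prod_list_diag_prod atLeast0LessThan)
  ultimately show ?thesis
    by (simp add: V_def)
qed

text \<open>The adjoint of \<open>V\<close> is the transpose of the Vandermonde matrix
  \<open>W\<close> of the conjugate nodes, so the determinant is that of \<open>V\<close> times its
  conjugate.\<close>

lemma vandermonde_gram:
  fixes u :: "nat \<Rightarrow> complex" and n :: nat
  defines "V \<equiv> Matrix.mat n n (\<lambda>(j, m). u j ^ m)"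
  defines "A \<equiv> V * Matrix.mat n n (\<lambda>(i, j). cnj (V $$ (j, i)))"
  shows "j < n \<Longrightarrow> k < n \<Longrightarrow> A $$ (j, k) = (\<Sum>m<n. (u j * cnj (u k)) ^ m)"
    and "Determinant.det A = complex_of_real (\<Prod>k<n. \<Prod>j<k. (cmod (u k - u j))\<^sup>2)"
proof -
  show "A $$ (j, k) = (\<Sum>m<n. (u j * cnj (u k)) ^ m)" if "j < n" "k < n"
    using that by (auto simp: A_def V_def scalar_prod_def atLeast0LessThan power_mult_distrib)
  define W where "W = Matrix.mat n n (\<lambda>(j, m). cnj (u j) ^ m)"
  have "Matrix.mat n n (\<lambda>(i, j). cnj (V $$ (j, i))) = transpose_mat W"
    by (rule eq_matI) (auto simp: V_def W_def)
  then have "Determinant.det A = Determinant.det V * Determinant.det W"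
    unfolding A_def using det_transpose[of W n]
    by (subst det_mult[of _ n]) (auto simp: V_def W_def)
  also have "\<dots> = (\<Prod>k<n. \<Prod>j<k. (u k - u j) * cnj (u k - u j))"
    unfolding V_def W_def det_vandermonde by (simp add: prod.distrib)
  also have "\<dots> = complex_of_real (\<Prod>k<n. \<Prod>j<k. (cmod (u k - u j))\<^sup>2)"
    unfolding of_real_prod by (simp only: complex_norm_square)
  finally show "Determinant.det A = complex_of_real (\<Prod>k<n. \<Prod>j<k. (cmod (u k - u j))\<^sup>2)" .
qed

lemma mult_cnj_unit:
  fixes z :: complex
  assumes "cmod z = 1"
  shows "z * cnj z = 1"
  using complex_norm_square[of z] assms by simp

lemma geometric_sum_eq_0_iff:
  fixes q :: complex
  assumes "q \<noteq> 1"
  shows "(\<Sum>m<n. q ^ m) = 0 \<longleftrightarrow> q ^ n = 1"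
  using assms by (simp add: geometric_sum)

text \<open>Unit nodes give the Gram matrix the diagonal entries \<open>n\<close>, so the
  determinant \<open>n ^ n\<close> is the equality case of Hadamard's inequality and the
  off-diagonal entries vanish. Such an entry is a geometric sum in the quotient \<open>q\<close> of
  two nodes; for \<open>q\<close> other than 1 it vanishes only if \<open>q ^ n = 1\<close>.\<close>

lemma vandermonde_extremal_imp_equal_powers:
  fixes u :: "nat \<Rightarrow> complex"
  assumes u: "\<And>k. k < n \<Longrightarrow> cmod (u k) = 1"
    and ext: "(\<Prod>k<n. \<Prod>j<k. (cmod (u k - u j))\<^sup>2) = real n ^ n"
    and jk: "j < n" "k < n"
  shows "u j ^ n = u k ^ n"
proof (cases "u j = u k")
  case False
  define q where "q = u j * cnj (u k)"
  define V where "V = Matrix.mat n n (\<lambda>(j, m). u j ^ m)"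
  have "(V * Matrix.mat n n (\<lambda>(i, j). cnj (V $$ (j, i)))) $$ (j, k) = 0"
  proof (rule gram_eq_diagonal[of _ _ "real n"])
    show "Determinant.det (V * Matrix.mat n n (\<lambda>(i, j). cnj (V $$ (j, i)))) = complex_of_real (real n ^ n)"
      unfolding V_def vandermonde_gram(2) ext ..
    show "(V * Matrix.mat n n (\<lambda>(i, j). cnj (V $$ (j, i)))) $$ (i, i) = complex_of_real (real n)" if "i < n" for i
      using that unfolding V_def by (subst vandermonde_gram(1)) (auto simp: mult_cnj_unit[OF u])
  qed (use jk False in \<open>auto simp: V_def\<close>)
  then have "(\<Sum>m<n. q ^ m) = 0"
    unfolding V_def q_def using jk by (subst (asm) vandermonde_gram(1)) auto
  moreover have "q * u k = u j"
    using mult_cnj_unit[OF u[OF jk(2)]] by (simp add: q_def mult_ac)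
  ultimately show ?thesis
    using False by (metis geometric_sum_eq_0_iff mult_1 power_mult_distrib)
qed simp

text \<open>The converse direction: quotients of distinct nodes are \<open>n\<close>-th roots of
  unity other than 1, so the geometric sums off the diagonal vanish and the Gram matrix is
  \<open>n\<close> times the identity.\<close>

lemma vandermonde_roots_extremal:
  fixes u :: "nat \<Rightarrow> complex"
  assumes u: "\<And>k. k < n \<Longrightarrow> cmod (u k) = 1"
    and inj: "inj_on u {..<n}"
    and pow: "\<And>k. k < n \<Longrightarrow> u k ^ n = c"
  shows "(\<Prod>k<n. \<Prod>j<k. (cmod (u k - u j))\<^sup>2) = real n ^ n"
proof -
  define V where "V = Matrix.mat n n (\<lambda>(j, m). u j ^ m)"
  define A where "A = V * Matrix.mat n n (\<lambda>(i, j). cnj (V $$ (j, i)))"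
  have off: "A $$ (j, k) = 0" if jk: "j < n" "k < n" "j \<noteq> k" for j k
  proof -
    have eq: "u j * cnj (u k) * u k = u j"
      using mult_cnj_unit[OF u[OF jk(2)]] by (simp add: mult_ac)
    have ne: "u j \<noteq> u k"
      using inj jk by (auto dest: inj_onD)
    have "(u j * cnj (u k)) ^ n = u j ^ n * cnj (u k ^ n)"
      by (simp add: power_mult_distrib)
    also have "\<dots> = u k ^ n * cnj (u k ^ n)"
      using pow jk by simp
    also have "\<dots> = 1"
      using u[OF jk(2)] by (intro mult_cnj_unit) (simp add: norm_power)
    finally have "(\<Sum>m<n. (u j * cnj (u k)) ^ m) = 0"
      using ne eq by (subst geometric_sum_eq_0_iff) (metis mult_1)+
    then show ?thesis
      unfolding A_def V_def using jk by (subst vandermonde_gram(1)) auto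
  qed
  have carr: "A \<in> carrier_mat n n"
    by (auto simp: A_def V_def)
  have "Determinant.det A = (\<Prod>i<n. A $$ (i, i))"
    using off carr by (subst det_upper_triangular[of _ n])
      (auto simp: upper_triangular_def prod_list_diag_prod atLeast0LessThan)
  also have "\<dots> = (\<Prod>i<n. complex_of_real (real n))"
    unfolding A_def V_def by (intro prod.cong refl, subst vandermonde_gram(1)) (auto simp: mult_cnj_unit[OF u])
  finally have "complex_of_real (\<Prod>k<n. \<Prod>j<k. (cmod (u k - u j))\<^sup>2) = complex_of_real (real n ^ n)"
    unfolding A_def V_def vandermonde_gram(2) by simp
  then show ?thesis
    by (simp only: of_real_eq_iff)
qed

section \<open>Products over pairs, discriminants and real-rooted polynomials\<close>

text \<open>Passes from the root indices 1, ..., d of the discriminant to indices starting at 0, as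
  used for matrices.\<close>

lemma prod_ordered_pairs:
  fixes h :: "nat \<Rightarrow> nat \<Rightarrow> 'a :: comm_monoid_mult"
  shows "(\<Prod>(j, k)\<in>{(j, k). 1 \<le> j \<and> j < k \<and> k \<le> d}. h j k) = (\<Prod>k<d. \<Prod>j<k. h (Suc j) (Suc k))"
proof -
  have "(\<Prod>k<d. \<Prod>j<k. h (Suc j) (Suc k)) = (\<Prod>(k, j)\<in>(SIGMA k:{..<d}. {..<k}). h (Suc j) (Suc k))"
    by (rule prod.Sigma) auto
  also have "\<dots> = (\<Prod>(j, k)\<in>{(j, k). 1 \<le> j \<and> j < k \<and> k \<le> d}. h j k)"
    by (rule prod.reindex_bij_witness[of _ "\<lambda>(j, k). (k - 1, j - 1)" "\<lambda>(k, j). (Suc j, Suc k)"]) auto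
  finally show ?thesis ..
qed

text \<open>Each of the \<open>d\<close> indices occurs in exactly \<open>d - 1\<close>
  pairs.\<close>

lemma prod_mult_pairs:
  fixes h :: "nat \<Rightarrow> 'a :: comm_semiring_1"
  shows "(\<Prod>k<d. \<Prod>j<k. h k * h j) = (\<Prod>k<d. h k) ^ (d - 1)"
proof (induction d)
  case (Suc d)
  have "(\<Prod>j<d. h d * h j) = h d ^ d * (\<Prod>j<d. h j)"
    by (simp add: prod.distrib)
  then have "(\<Prod>k<Suc d. \<Prod>j<k. h k * h j) = (\<Prod>k<d. h k) ^ (d - 1) * (h d ^ d * (\<Prod>j<d. h j))"
    using Suc by simp
  also have "\<dots> = (\<Prod>k<d. h k) ^ d * h d ^ d"
    by (cases d) (simp_all add: mult_ac)
  finally show ?case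
    by (simp add: power_mult_distrib)
qed simp

lemma map_poly_of_real_linear_factors:
  fixes x :: "'a \<Rightarrow> real"
  shows
  "map_poly complex_of_real (\<Prod>k\<in>I. [:- x k, 1:]) = (\<Prod>k\<in>I. [:- complex_of_real (x k), 1:])"
proof -
  interpret of_real_poly: map_poly_inj_idom_hom complex_of_real ..
  show ?thesis
    by (simp add: of_real_poly.hom_prod)
qed

lemma map_poly_of_real_eq_iff:
  "map_poly complex_of_real p = map_poly complex_of_real q \<longleftrightarrow> p = q"
proof -
  interpret of_real_poly: map_poly_inj_idom_hom complex_of_real ..
  show ?thesis
    by simp
qed

lemma discriminant_real_linear_factors:
  fixes x :: "nat \<Rightarrow> real"
  shows
  "discriminant (\<Prod>k<d. [:- complex_of_real (x k), 1:]) =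
     complex_of_real (\<Prod>k<d. \<Prod>j<k. (x k - x j)\<^sup>2)"
proof -
  have "(\<Prod>k<d. [:- complex_of_real (x k), 1:]) = (\<Prod>k\<in>{1..d}. [:- complex_of_real (x (k - 1)), 1:])"
    by (rule prod.reindex_bij_witness[of _ "\<lambda>k. k - 1" Suc]) auto
  then have "discriminant (\<Prod>k<d. [:- complex_of_real (x k), 1:]) =
      (\<Prod>k<d. \<Prod>j<k. (complex_of_real (x j) - complex_of_real (x k))\<^sup>2)"
    by (simp only: discriminant_eq prod_ordered_pairs) simp
  also have "\<dots> = complex_of_real (\<Prod>k<d. \<Prod>j<k. (x k - x j)\<^sup>2)"
    by (simp add: power2_commute)
  finally show ?thesis .
qed

text \<open>A member of \<open>K d D\<close> splits into linear factors over the complex numbers,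
  and its roots are real by definition, so the factorization descends to real polynomials.\<close>

lemma mem_K_iff:
  "f \<in> K d D \<longleftrightarrow>
     (\<exists>x. f = (\<Prod>k<d. [:- x k, 1:]) \<and> (\<Prod>k<d. \<Prod>j<k. (x k - x j)\<^sup>2) = D)"
proof
  assume f: "f \<in> K d D"
  define F where "F = map_poly complex_of_real f"
  have deg: "degree f = d" "lead_coeff f = 1" "degree F = d" "lead_coeff F = 1"
    using f by (auto simp: K_def F_def degree_map_poly coeff_map_poly)
  obtain as where as: "Polynomial.smult (lead_coeff F) (\<Prod>a\<leftarrow>as. [:- a, 1:]) = F" "length as = d"
    using fundamental_theorem_algebra_factorized[of F] deg by auto
  define x where "x k = Re (as ! k)" for k
  have F: "F = (\<Prod>a\<leftarrow>as. [:- a, 1:])"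
    using as(1) deg by simp
  have x: "as ! k = complex_of_real (x k)" if "k < d" for k
  proof -
    have "poly F (as ! k) = 0"
      unfolding F using that as(2) by (auto simp: poly_prod_list prod_list_zero_iff)
    then have "as ! k \<in> \<real>"
      using f by (auto simp: K_def F_def)
    then show ?thesis
      by (simp add: x_def)
  qed
  have "F = (\<Prod>k<d. [:- as ! k, 1:])"
    unfolding F by (simp add: prod.list_conv_set_nth as(2) atLeast0LessThan)
  also have "\<dots> = (\<Prod>k<d. [:- complex_of_real (x k), 1:])"
    by (intro prod.cong refl) (simp add: x)
  finally have F': "F = (\<Prod>k<d. [:- complex_of_real (x k), 1:])" .
  have "f = (\<Prod>k<d. [:- x k, 1:])"
    using F' by (simp add: F_def flip: map_poly_of_real_eq_iff map_poly_of_real_linear_factors)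
  moreover have "complex_of_real (\<Prod>k<d. \<Prod>j<k. (x k - x j)\<^sup>2) = complex_of_real D"
    using f F' by (simp add: K_def F_def discriminant_real_linear_factors)
  ultimately show "\<exists>x. f = (\<Prod>k<d. [:- x k, 1:]) \<and> (\<Prod>k<d. \<Prod>j<k. (x k - x j)\<^sup>2) = D"
    unfolding of_real_eq_iff by blast
next
  assume "\<exists>x. f = (\<Prod>k<d. [:- x k, 1:]) \<and> (\<Prod>k<d. \<Prod>j<k. (x k - x j)\<^sup>2) = D"
  then obtain x where x: "f = (\<Prod>k<d. [:- x k, 1:])" "(\<Prod>k<d. \<Prod>j<k. (x k - x j)\<^sup>2) = D"
    by blast
  have "degree f = d"
    unfolding x(1) by (subst degree_prod_sum_eq) auto
  moreover have "lead_coeff f = 1"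
    unfolding x(1) by (simp add: lead_coeff_prod)
  moreover have "z \<in> \<real>" if "poly (map_poly complex_of_real f) z = 0" for z
    using that unfolding x(1) map_poly_of_real_linear_factors by (auto simp: poly_prod)
  moreover have "discriminant (map_poly complex_of_real f) = complex_of_real D"
    unfolding x(1) map_poly_of_real_linear_factors discriminant_real_linear_factors x(2) ..
  ultimately show "f \<in> K d D"
    by (simp add: K_def)
qed

text \<open>Both sides have the same coefficient at \<open>d\<close> and agree at \<open>d\<close>
  distinct points. Taking \<open>coeff p d\<close> instead of the leading coefficient also covers
  \<open>p\<close> of degree below \<open>d\<close>; then both sides are 0.\<close>

lemma poly_eq_smult_linear_factors:
  fixes p :: "'a :: idom poly"
  assumes "degree p \<le> d" "inj_on x {..<d}" "\<And>k. k < d \<Longrightarrow> poly p (x k) = 0"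
  shows "p = Polynomial.smult (coeff p d) (\<Prod>k<d. [:- x k, 1:])"
proof -
  define P where "P = (\<Prod>k<d. [:- x k, 1:])"
  have deg: "degree P = d"
    unfolding P_def by (subst degree_prod_sum_eq) auto
  have "lead_coeff P = 1"
    unfolding P_def by (simp add: lead_coeff_prod)
  then have lead: "coeff P d = 1"
    by (simp add: deg)
  have "p = Polynomial.smult (coeff p d) P"
  proof (rule poly_eqI_degree_lead_coeff[where A = "x ` {..<d}" and n = d])
    show "poly p z = poly (Polynomial.smult (coeff p d) P) z" if "z \<in> x ` {..<d}" for z
      using that assms(3) by (auto simp: P_def poly_prod)
  qed (use assms lead deg in \<open>auto simp: card_image intro: order.trans[OF degree_smult_le]\<close>)
  then show ?thesis
    by (simp add: P_def)
qed

section \<open>The Cayley transform\<close>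

text \<open>With denominators \<open>w k\<close>, the difference \<open>u k - u j\<close> is
  \<open>2 * b * (x k - x j) / (w k * w j)\<close>. Squared moduli are multiplied over all pairs,
  where each denominator occurs \<open>d - 1\<close> times.\<close>

lemma cayley_discriminant:
  fixes x :: "nat \<Rightarrow> real" and a :: real
  assumes a: "a > 0"
  defines "u \<equiv> \<lambda>k. (complex_of_real (x k) - complex_of_real a * \<i>) / (complex_of_real (x k) + complex_of_real a * \<i>)"
  shows "(\<Prod>k<d. \<Prod>j<k. (cmod (u k - u j))\<^sup>2)
           * (cmod (\<Prod>k<d. complex_of_real (x k) + complex_of_real a * \<i>) ^ (d - 1))\<^sup>2
         = ((2 * a) ^ d) ^ (d - 1) * (\<Prod>k<d. \<Prod>j<k. (x k - x j)\<^sup>2)"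
proof -
  define b where "b = complex_of_real a * \<i>"
  define w where "w k = complex_of_real (x k) + b" for k
  have w: "w k \<noteq> 0" for k
    using a by (auto simp: w_def b_def complex_eq_iff)
  \<comment> \<open>The constant is left as a product of two equal factors, so that
    \<open>prod_mult_pairs\<close> applies to it with a constant function.\<close>
  have pair: "(cmod (u k - u j))\<^sup>2 * ((cmod (w k))\<^sup>2 * (cmod (w j))\<^sup>2) = (2 * a) * (2 * a) * (x k - x j)\<^sup>2" for j k
  proof -
    have uw: "u i * w i = complex_of_real (x i) - b" for i
      using w[of i] by (simp add: u_def w_def b_def)
    have "(u k - u j) * (w k * w j) = (u k * w k) * w j - (u j * w j) * w k"
      by (simp add: algebra_simps)
    also have "\<dots> = 2 * b * complex_of_real (x k - x j)"
      by (simp only: uw) (simp add: w_def algebra_simps)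
    finally have "(u k - u j) * (w k * w j) = 2 * b * complex_of_real (x k - x j)" .
    then have "cmod ((u k - u j) * (w k * w j)) = cmod (2 * b * complex_of_real (x k - x j))"
      by (rule arg_cong)
    then have "cmod (u k - u j) * (cmod (w k) * cmod (w j)) = 2 * a * \<bar>x k - x j\<bar>"
      using a by (simp add: b_def norm_mult del: of_real_diff)
    then have "(cmod (u k - u j) * (cmod (w k) * cmod (w j)))\<^sup>2 = (2 * a * \<bar>x k - x j\<bar>)\<^sup>2"
      by (rule arg_cong)
    then show ?thesis
      by (simp only: power_mult_distrib power2_abs) (simp add: power2_eq_square)
  qed
  have "(\<Prod>k<d. \<Prod>j<k. (cmod (u k - u j))\<^sup>2) * (\<Prod>k<d. \<Prod>j<k. (cmod (w k))\<^sup>2 * (cmod (w j))\<^sup>2)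
      = (\<Prod>k<d. \<Prod>j<k. (2 * a) * (2 * a)) * (\<Prod>k<d. \<Prod>j<k. (x k - x j)\<^sup>2)"
    unfolding prod.distrib[symmetric] pair ..
  moreover have "(\<Prod>k<d. (cmod (w k))\<^sup>2) ^ (d - 1) = (cmod (\<Prod>k<d. w k) ^ (d - 1))\<^sup>2"
    by (simp only: prod_norm[symmetric] prod_power_distrib[symmetric] power_mult[symmetric] mult.commute)
  ultimately show ?thesis
    unfolding prod_mult_pairs by (simp add: w_def b_def)
qed

text \<open>The numerator is the conjugate of the denominator. In the exceptional case both are 0,
  and division by zero yields 0.\<close>

lemma cmod_cayley:
  "cmod ((complex_of_real x - complex_of_real a * \<i>) / (complex_of_real x + complex_of_real a * \<i>)) =
     (if x = 0 \<and> a = 0 then 0 else 1)"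
proof -
  have "complex_of_real x - complex_of_real a * \<i> = cnj (complex_of_real x + complex_of_real a * \<i>)"
    by simp
  then have "cmod (complex_of_real x - complex_of_real a * \<i>) = cmod (complex_of_real x + complex_of_real a * \<i>)"
    by (simp only: complex_mod_cnj)
  then show ?thesis
    by (simp add: norm_divide complex_eq_iff)
qed

text \<open>Serves to show that the inverse Cayley transform takes the unit circle without 1 to the
  real line.\<close>

lemma Im_eq_0_if_equidistant:
  fixes a :: real
  assumes "cmod (z - complex_of_real a * \<i>) = cmod (z + complex_of_real a * \<i>)" "a \<noteq> 0"
  shows "Im z = 0"
proof -
  have "(Re z)\<^sup>2 + (Im z - a)\<^sup>2 = (Re z)\<^sup>2 + (Im z + a)\<^sup>2"
    using assms(1) by (simp add: cmod_def)
  then have "a * Im z = 0"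
    by (simp add: power2_eq_square algebra_simps)
  then show ?thesis
    using assms(2) by simp
qed

text \<open>The squared modulus of \<open>1 - c\<close> is \<open>2 - 2 * Re c\<close>, which equals
  4 only for \<open>Re c = -1\<close>; then \<open>Im c = 0\<close>.\<close>

lemma minus_one_if_unit_and_antipodal:
  fixes c :: complex
  assumes "cmod c = 1" "cmod (1 - c) = 2"
  shows "c = -1"
proof -
  have "(Re c)\<^sup>2 + (Im c)\<^sup>2 = 1" "(1 - Re c)\<^sup>2 + (Im c)\<^sup>2 = 4"
    using assms cmod_power2[of c] cmod_power2[of "1 - c"] by auto
  moreover from this have "Re c = -1"
    by (simp add: power2_eq_square algebra_simps)
  ultimately show ?thesis
    by (simp add: complex_eq_iff)
qed

section \<open>The extremal polynomial\<close>

text \<open>A complex polynomial, since \<open>b\<close> will be imaginary. A real polynomial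
  mapping to it is obtained later from its factorization with real roots.\<close>

definition extremal_poly :: "nat \<Rightarrow> complex \<Rightarrow> complex poly" where
  "extremal_poly d b = Polynomial.smult (1 / 2) ([:b, 1:] ^ d + [:- b, 1:] ^ d)"

lemma poly_extremal_poly: "poly (extremal_poly d b) z = ((z + b) ^ d + (z - b) ^ d) / 2"
  by (simp add: extremal_poly_def poly_power add.commute)

lemma degree_linear_power: "degree ([:b, 1:] ^ d) = d" and coeff_linear_power: "coeff ([:b, 1:] ^ d) d = 1"
  for b :: "'a :: idom"
proof -
  show "degree ([:b, 1:] ^ d) = d"
    by (simp add: degree_power_eq)
  then show "coeff ([:b, 1:] ^ d) d = 1"
    using lead_coeff_power[of "[:b, 1:]" d] by simp
qed

lemma degree_extremal_poly: "degree (extremal_poly d b) \<le> d"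
  unfolding extremal_poly_def
  by (intro order.trans[OF degree_smult_le] degree_add_le) (simp_all add: degree_linear_power)

lemma coeff_extremal_poly: "coeff (extremal_poly d b) d = 1"
  by (simp add: extremal_poly_def coeff_linear_power)

text \<open>The roots are the points whose Cayley transform \<open>u\<close> satisfies
  \<open>u ^ d = -1\<close>. This equation has \<open>d\<close> distinct solutions, all on the unit
  circle and different from 1, so they come from \<open>d\<close> distinct real roots.\<close>

lemma extremal_poly_splits:
  fixes a :: real
  assumes a: "a > 0" and d: "d > 0"
  obtains x :: "nat \<Rightarrow> real" where
    "extremal_poly d (complex_of_real a * \<i>) = (\<Prod>k<d. [:- complex_of_real (x k), 1:])"
    "inj_on (\<lambda>k. (complex_of_real (x k) - complex_of_real a * \<i>) / (complex_of_real (x k) + complex_of_real a * \<i>)) {..<d}"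
    "\<And>k. k < d \<Longrightarrow>
       ((complex_of_real (x k) - complex_of_real a * \<i>) / (complex_of_real (x k) + complex_of_real a * \<i>)) ^ d = -1"
proof -
  define b where "b = complex_of_real a * \<i>"
  have "card {z::complex. z ^ d = -1} = d"
    by (rule card_nth_roots) (use d in auto)
  moreover from this have "finite {z::complex. z ^ d = -1}"
    using d by (intro card_ge_0_finite) simp
  ultimately obtain u where u: "bij_betw u {..<d} {z::complex. z ^ d = -1}"
    using ex_bij_betw_nat_finite by (metis atLeast0LessThan)
  have ud: "u k ^ d = -1" if "k < d" for k
    using u that by (auto simp: bij_betw_def)
  have u1: "u k \<noteq> 1" if "k < d" for k
    using ud[OF that] by auto
  \<comment> \<open>This solves \<open>(x - b) / (x + b) = u k\<close> for \<open>x\<close>. Taking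
    \<open>Re\<close> only changes the type: the solution is shown to be real next.\<close>
  define x where "x k = Re (b * (1 + u k) / (1 - u k))" for k
  have "complex_of_real (x k) = b * (1 + u k) / (1 - u k)" if k: "k < d" for k
  proof -
    define y where "y = b * (1 + u k) / (1 - u k)"
    have "cmod (u k) ^ d = 1"
      using arg_cong[OF ud[OF k], of cmod] by (simp add: norm_power)
    then have "cmod (u k) = 1"
      using d power_eq_imp_eq_base[of "cmod (u k)" d 1] by simp
    moreover have "y - b = u k * (y + b)"
      using u1[OF k] by (simp add: y_def field_simps)
    ultimately have "cmod (y - b) = cmod (y + b)"
      by (simp add: norm_mult)
    then have "Im y = 0"
      unfolding b_def by (rule Im_eq_0_if_equidistant) (use a in simp)
    then show ?thesis
      by (simp add: x_def complex_eq_iff flip: y_def)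
  qed
  then have xu: "complex_of_real (x k) - b = u k * (complex_of_real (x k) + b)" if "k < d" for k
    using u1[OF that] that by (simp add: field_simps)
  have nz: "complex_of_real t + b \<noteq> 0" for t
    using a by (auto simp: b_def complex_eq_iff)
  have u_eq: "(complex_of_real (x k) - b) / (complex_of_real (x k) + b) = u k" if "k < d" for k
    using xu[OF that] nz by simp
  have inj: "inj_on x {..<d}"
  proof (rule inj_onI)
    fix j k assume jk: "j \<in> {..<d}" "k \<in> {..<d}" "x j = x k"
    then have "u j = u k"
      using u_eq[of j] u_eq[of k] by simp
    then show "j = k"
      using u jk by (auto simp: bij_betw_def dest: inj_onD)
  qed
  have "poly (extremal_poly d b) (complex_of_real (x k)) = 0" if "k < d" for k
    using xu[OF that] ud[OF that] by (simp add: poly_extremal_poly power_mult_distrib)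
  then have "extremal_poly d b = Polynomial.smult (coeff (extremal_poly d b) d) (\<Prod>k<d. [:- complex_of_real (x k), 1:])"
    using inj by (intro poly_eq_smult_linear_factors) (auto simp: degree_extremal_poly inj_on_def)
  then have "extremal_poly d b = (\<Prod>k<d. [:- complex_of_real (x k), 1:])"
    by (simp add: coeff_extremal_poly)
  moreover have "inj_on (\<lambda>k. (complex_of_real (x k) - b) / (complex_of_real (x k) + b)) {..<d}"
    using u by (auto simp: bij_betw_def inj_on_def u_eq)
  ultimately show ?thesis
    using that[of x] u_eq ud by (simp add: b_def)
qed

text \<open>Reflection in the imaginary axis preserves each distance. This identifies the
  denominators in \<open>cayley_discriminant\<close> with the value of the polynomial.\<close>

lemma poly_linear_factors_imaginary:
  fixes x :: "nat \<Rightarrow> real" and a :: real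
  shows "cmod (poly (\<Prod>k<d. [:- complex_of_real (x k), 1:]) (complex_of_real a * \<i>)) =
    cmod (\<Prod>k<d. complex_of_real (x k) + complex_of_real a * \<i>)"
proof -
  have "cmod (poly [:- complex_of_real y, 1:] (complex_of_real a * \<i>)) = cmod (complex_of_real y + complex_of_real a * \<i>)" for y
    by (simp add: cmod_def)
  then show ?thesis
    by (simp only: poly_prod prod_norm[symmetric])
qed

lemma extremal_imp_eq_extremal_poly:
  fixes x :: "nat \<Rightarrow> real" and a :: real
  defines "u \<equiv> \<lambda>k. (complex_of_real (x k) - complex_of_real a * \<i>) / (complex_of_real (x k) + complex_of_real a * \<i>)"
  assumes a: "a > 0" and d: "d > 0" and inj: "inj_on x {..<d}"
    and pow: "\<And>j k. j < d \<Longrightarrow> k < d \<Longrightarrow> u j ^ d = u k ^ d"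
    and val: "cmod (poly (\<Prod>k<d. [:- complex_of_real (x k), 1:]) (complex_of_real a * \<i>)) = (2 * a) ^ d / 2"
  shows "(\<Prod>k<d. [:- complex_of_real (x k), 1:]) = extremal_poly d (complex_of_real a * \<i>)"
proof -
  define b where "b = complex_of_real a * \<i>"
  define P where "P = (\<Prod>k<d. [:- complex_of_real (x k), 1:])"
  \<comment> \<open>The common value of all the powers; the index 0 is available because
    \<open>d > 0\<close>.\<close>
  define c where "c = u 0 ^ d"
  define H where "H = [:- b, 1:] ^ d - Polynomial.smult c ([:b, 1:] ^ d)"
  have nz: "complex_of_real t + b \<noteq> 0" for t
    using a by (auto simp: b_def complex_eq_iff)
  have "poly H (complex_of_real (x k)) = 0" if "k < d" for k
  proof -
    have "complex_of_real (x k) - b = u k * (complex_of_real (x k) + b)"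
      using nz by (simp add: u_def b_def)
    moreover have "u k ^ d = c"
      unfolding c_def using that d by (intro pow)
    ultimately show ?thesis
      by (simp add: H_def poly_power add.commute power_mult_distrib)
  qed
  moreover have "degree H \<le> d"
    unfolding H_def by (intro degree_diff_le order.trans[OF degree_smult_le]) (simp_all add: degree_linear_power)
  ultimately have "H = Polynomial.smult (coeff H d) P"
    unfolding P_def using inj by (intro poly_eq_smult_linear_factors) (auto simp: inj_on_def)
  \<comment> \<open>At this point \<open>1 - c\<close> might still be 0; the evaluation at
    \<open>b\<close> settles that.\<close>
  then have H: "H = Polynomial.smult (1 - c) P"
    by (simp add: H_def coeff_linear_power)
  have "cmod c = 1"
    using a by (simp add: c_def u_def norm_power cmod_cayley)
  moreover have "cmod (1 - c) = 2"
  proof -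
    \<comment> \<open>The first term of \<open>H\<close> vanishes at \<open>b\<close>, and the
      modulus \<open>(2 * a) ^ d\<close> of the other is twice the prescribed modulus of
      \<open>poly P b\<close>.\<close>
    have "poly H b = - c * (2 * b) ^ d"
      using d by (simp add: H_def poly_power)
    then have "- c * (2 * b) ^ d = (1 - c) * poly P b"
      by (simp add: H)
    then have "cmod (- c * (2 * b) ^ d) = cmod ((1 - c) * poly P b)"
      by (rule arg_cong)
    then show ?thesis
      using val \<open>cmod c = 1\<close> a by (simp add: norm_mult norm_power b_def P_def)
  qed
  ultimately have "c = -1"
    by (rule minus_one_if_unit_and_antipodal)
  then have "[:- b, 1:] ^ d + [:b, 1:] ^ d = Polynomial.smult 2 P"
    using H by (simp add: H_def)
  then show ?thesis
    by (simp add: extremal_poly_def add.commute flip: P_def b_def)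
qed

section \<open>The constants\<close>

text \<open>The first equation says that the extremal polynomial takes a value of modulus
  \<open>v\<close> at \<open>a\<close> times the imaginary unit. The second turns
  \<open>cayley_discriminant\<close>, for discriminant \<open>D\<close> and value \<open>v\<close>,
  into the statement that the product of squared distances is \<open>d ^ d\<close>.\<close>

lemma extremal_constants:
  fixes D a :: real and d :: nat
  assumes D: "D > 0" and d: "d \<ge> 2"
    and a: "a = 2 powr (- 1 + 2 / real d) * real d powr (- 1 / (real d - 1))
              * D powr (1 / (real d * (real d - 1)))"
  defines "v \<equiv> 2 * real d powr (- real d / (real d - 1)) * D powr (1 / (real d - 1))"
  shows "(2 * a) ^ d = 2 * v" and "((2 * a) ^ d) ^ (d - 1) * D = real d ^ d * (v ^ (d - 1))\<^sup>2"
proof -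
  have d': "real d > 1"
    using d by simp
  have "2 * a = 2 powr (2 / real d) * real d powr (- 1 / (real d - 1)) * D powr (1 / (real d * (real d - 1)))"
    unfolding a by (simp add: powr_diff)
  then have "(2 * a) ^ d = (2 powr (2 / real d)) ^ d * (real d powr (- 1 / (real d - 1))) ^ d
      * (D powr (1 / (real d * (real d - 1)))) ^ d"
    by (simp only: power_mult_distrib)
  also have "(2 powr (2 / real d)) ^ d = (2::real) powr 2"
    using d' by (simp add: powr_powr flip: powr_realpow)
  also have "(real d powr (- 1 / (real d - 1))) ^ d = real d powr (- real d / (real d - 1))"
    using d' by (simp add: powr_powr flip: powr_realpow)
  also have "(D powr (1 / (real d * (real d - 1)))) ^ d = D powr (1 / (real d - 1))"
    using d' D by (simp add: powr_powr flip: powr_realpow)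
  finally show av: "(2 * a) ^ d = 2 * v"
    by (simp add: v_def)
  have "v ^ (d - 1) = 2 ^ (d - 1) * (real d powr (- real d / (real d - 1))) ^ (d - 1)
      * (D powr (1 / (real d - 1))) ^ (d - 1)"
    unfolding v_def by (simp only: power_mult_distrib)
  also have "(real d powr (- real d / (real d - 1))) ^ (d - 1) = real d powr (- real d)"
    using d' d by (simp add: powr_powr of_nat_diff flip: powr_realpow)
  also have "\<dots> = 1 / real d ^ d"
    using d' by (simp add: powr_minus powr_realpow field_simps)
  also have "(D powr (1 / (real d - 1))) ^ (d - 1) = D"
    using d' D d by (simp add: powr_powr of_nat_diff flip: powr_realpow)
  finally have "v ^ (d - 1) * real d ^ d = 2 ^ (d - 1) * D"
    using d' by simp
  \<comment> \<open>By the first equation the left side is \<open>v ^ (d - 1)\<close> times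
    \<open>2 ^ (d - 1) * D\<close>, and the latter has just been computed.\<close>
  then show "((2 * a) ^ d) ^ (d - 1) * D = real d ^ d * (v ^ (d - 1))\<^sup>2"
    unfolding av by (simp add: power_mult_distrib power2_eq_square mult_ac)
qed

section \<open>Existence and uniqueness of the extremal polynomial\<close>

theorem corollary7:
  fixes D a\<^sub>0 :: real and d :: nat
  assumes "D > 0" and "d \<ge> 2"
    and "a\<^sub>0 = 2 powr (- 1 + 2 / real d) * real d powr (- 1 / (real d - 1))
              * D powr (1 / (real d * (real d - 1)))"
  shows "\<exists>f\<in>K d D.
           (\<forall>z::complex. poly (map_poly complex_of_real f) z
              = ((z + complex_of_real a\<^sub>0 * \<i>) ^ d + (z - complex_of_real a\<^sub>0 * \<i>) ^ d) / 2) \<and>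
           (\<forall>g\<in>K d D.
              cmod (poly (map_poly complex_of_real g) (complex_of_real a\<^sub>0 * \<i>))
                = 2 * real d powr (- real d / (real d - 1)) * D powr (1 / (real d - 1))
              \<longleftrightarrow> g = f)"
proof -
  define b where "b = complex_of_real a\<^sub>0 * \<i>"
  define v where "v = 2 * real d powr (- real d / (real d - 1)) * D powr (1 / (real d - 1))"
  define u where "u x k = (complex_of_real (x k) - b) / (complex_of_real (x k) + b)" for x :: "nat \<Rightarrow> real" and k
  define P where "P x = (\<Prod>k<d. [:- complex_of_real (x k), 1:])" for x :: "nat \<Rightarrow> real"
  have d: "d > 0"
    using assms(2) by simp
  have a: "a\<^sub>0 > 0"
    using assms by simp
  have v: "v > 0"
    using assms by (simp add: v_def)
  note const = extremal_constants[OF assms, folded v_def]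
  have cayley: "(\<Prod>k<d. \<Prod>j<k. (cmod (u x k - u x j))\<^sup>2) * (cmod (poly (P x) b) ^ (d - 1))\<^sup>2
      = ((2 * a\<^sub>0) ^ d) ^ (d - 1) * (\<Prod>k<d. \<Prod>j<k. (x k - x j)\<^sup>2)" for x
    unfolding P_def b_def poly_linear_factors_imaginary u_def by (rule cayley_discriminant[OF a])
  have unit: "cmod (u x k) = 1" for x k
    using a by (simp add: u_def b_def cmod_cayley)
  have val: "cmod (poly (extremal_poly d b) b) = v"
  proof -
    have "cmod (poly (extremal_poly d b) b) = cmod ((2 * b) ^ d / 2)"
      using d by (simp add: poly_extremal_poly zero_power)
    also have "\<dots> = (2 * a\<^sub>0) ^ d / 2"
      using a by (simp add: norm_divide norm_power norm_mult b_def)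
    finally show ?thesis
      unfolding const(1) by simp
  qed

  obtain x where x: "extremal_poly d b = P x" "inj_on (u x) {..<d}" "\<And>k. k < d \<Longrightarrow> u x k ^ d = -1"
    using extremal_poly_splits[OF a d] unfolding b_def P_def u_def by blast
  define f where "f = (\<Prod>k<d. [:- x k, 1:])"
  have f: "map_poly complex_of_real f = extremal_poly d b"
    by (simp only: f_def map_poly_of_real_linear_factors x(1) P_def)
  \<comment> \<open>Existence: the product of squared distances and the value at \<open>b\<close>
    are both known, so the Cayley identity can be solved for the discriminant.\<close>
  have "(\<Prod>k<d. \<Prod>j<k. (cmod (u x k - u x j))\<^sup>2) = real d ^ d"
    by (rule vandermonde_roots_extremal[OF unit x(2,3)])
  then have "((2 * a\<^sub>0) ^ d) ^ (d - 1) * (\<Prod>k<d. \<Prod>j<k. (x k - x j)\<^sup>2) = ((2 * a\<^sub>0) ^ d) ^ (d - 1) * D"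
    using cayley[of x] unfolding x(1)[symmetric] val const(2) by simp
  then have "f \<in> K d D"
    using a by (auto simp: mem_K_iff f_def)

  moreover have "g = f" if g: "g \<in> K d D" and gv: "cmod (poly (map_poly complex_of_real g) b) = v" for g
  proof -
    obtain y where y: "g = (\<Prod>k<d. [:- y k, 1:])" "(\<Prod>k<d. \<Prod>j<k. (y k - y j)\<^sup>2) = D"
      using g by (auto simp: mem_K_iff)
    have gP: "map_poly complex_of_real g = P y"
      by (simp only: y(1) map_poly_of_real_linear_factors P_def)
    \<comment> \<open>Uniqueness uses the same identity the other way: discriminant and value are
      given, and cancelling the positive power of \<open>v\<close> leaves the extremal
      product.\<close>
    have "(\<Prod>k<d. \<Prod>j<k. (cmod (u y k - u y j))\<^sup>2) = real d ^ d"
      using cayley[of y] gv v unfolding gP y(2) const(2) by simp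
    then have pow: "u y j ^ d = u y k ^ d" if "j < d" "k < d" for j k
      using vandermonde_extremal_imp_equal_powers[of d "u y", OF unit] that by blast
    \<comment> \<open>A repeated root would make the discriminant 0, contrary to
      \<open>D > 0\<close>.\<close>
    have "y j \<noteq> y k" if "j < k" "k < d" for j k
    proof
      assume "y j = y k"
      then have zero: "(\<Prod>j<k. (y k - y j)\<^sup>2) = 0"
        using that by (intro prod_zero bexI[of _ j]) auto
      have "\<exists>i\<in>{..<d}. (\<Prod>j<i. (y i - y j)\<^sup>2) = 0"
        by (rule bexI[where x = k]) (use that zero in simp_all)
      then have "(\<Prod>k<d. \<Prod>j<k. (y k - y j)\<^sup>2) = 0"
        by (rule prod_zero[OF finite_lessThan])
      then show False
        using y(2) assms(1) by simp
    qed
    then have "inj_on y {..<d}"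
      by (intro linorder_inj_onI) auto
    then have "P y = extremal_poly d b"
      unfolding P_def b_def
    proof (rule extremal_imp_eq_extremal_poly[OF a d])
      show "cmod (poly (\<Prod>k<d. [:- complex_of_real (y k), 1:]) (complex_of_real a\<^sub>0 * \<i>)) = (2 * a\<^sub>0) ^ d / 2"
        using gv unfolding gP P_def b_def const(1) by simp
    qed (rule pow[unfolded u_def b_def])
    then show "g = f"
      by (simp add: f gP flip: map_poly_of_real_eq_iff)
  qed
  ultimately show ?thesis
    unfolding b_def[symmetric] v_def[symmetric]
    using f val by (metis poly_extremal_poly)
qed

end
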